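(* Assume that $a$ and $b$ are not both in $\mathbb{F}_q$. Put $e_0'=0$. Then for any integer $e\ge 1$ we have $e_{i-1}'<e\le e_i'$ for some integer $i\ge 1$, and moreover $\pi(P^e)=\pi(P^{e_i'})=p^{i-1}\pi(P)$.
   Context: Let $\mathbb{F}_q$ be the finite field with $q=p^l$ elements, $p$ prime, $l\ge1$. Fix $a,b\in\mathbb{F}_q[x]$ with $b\neq 0$. The generalized Fibonacci sequence is $F_0=0$, $F_1=1$, $F_n=aF_{n-1}+bF_{n-2}$ for $n\ge 2$. Fix an irreducible polynomial $P\in\mathbb{F}_q[x]$ with $\gcd(b,P)=1$. For a non-constant $M\in\mathbb{F}_q[x]$ with $\gcd(b,M)=1$, the period $\pi(M)$ is the least positive integer $n$ with $F_n\equiv 0$ and $F_{n+1}\equiv 1\pmod M$. For $i\ge 1$, $e_i'$ denotes the $i$-th smallest positive integer $e$ such that $\pi(P^e)\neq\pi(P^{e+1})$ (under the hypotheses of the claim, all $e_i'$ exist). *)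

theory Defs
  imports
    "HOL-Computational_Algebra.Polynomial_Factorial"
    "HOL-Library.Cardinality"
    "HOL-Library.Infinite_Set"
    "HOL-Number_Theory.Cong"
begin

fun gfib :: "'a::comm_ring_1 poly \<Rightarrow> 'a poly \<Rightarrow> nat \<Rightarrow> 'a poly" where
  "gfib a b 0 = 0"
| "gfib a b (Suc 0) = 1"
| "gfib a b (Suc (Suc n)) = a * gfib a b (Suc n) + b * gfib a b n"

text \<open>
  Only meaningful for non-constant \<open>M\<close> coprime to \<open>b\<close> over a finite field,
  where the set minimised over is nonempty.
\<close>

definition period :: "'a::field poly \<Rightarrow> 'a poly \<Rightarrow> 'a poly \<Rightarrow> nat" where
  "period a b M =
     (LEAST n. n > 0 \<and> [gfib a b n = 0] (mod M) \<and> [gfib a b (n + 1) = 1] (mod M))"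

definition jumps :: "'a::field poly \<Rightarrow> 'a poly \<Rightarrow> 'a poly \<Rightarrow> nat set" where
  "jumps a b P = {e. e > 0 \<and> period a b (P ^ e) \<noteq> period a b (P ^ (e + 1))}"

text \<open>
  \<open>nth_jump a b P i\<close> is \<open>e'\<^sub>i\<close>, with the convention \<open>e'\<^sub>0 = 0\<close>. As
  \<open>enumerate\<close> counts from 0, the \<open>i\<close>-th smallest jump is \<open>enumerate _ (i - 1)\<close>;
  this is meaningful for all \<open>i \<ge> 1\<close> when there are infinitely many jumps.
\<close>

definition nth_jump :: "'a::field poly \<Rightarrow> 'a poly \<Rightarrow> 'a poly \<Rightarrow> nat \<Rightarrow> nat" where
  "nth_jump a b P i = (if i = 0 then 0 else enumerate (jumps a b P) (i - 1))"

end

theory Submission imports Defs "HOL-Number_Theory.Residues" begin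

text \<open>
  Let \<open>F\<close> be the sequence \<open>gfib a b\<close> and \<open>t\<close> a root of \<open>C = t\<^sup>2 - a t - b\<close>. In the quotient by \<open>C\<close>
  one has \<open>t\<^sup>n = F\<^sub>n t + G\<^sub>n\<close> with \<open>G\<^sub>n = F\<^sub>n\<^sub>+\<^sub>1 - a F\<^sub>n\<close>, so \<open>n\<close> satisfies the congruences that define
  the period modulo \<open>M\<close> exactly when \<open>t\<^sup>n = 1\<close> modulo \<open>C\<close> and \<open>M\<close>. The period is therefore the order of
  \<open>t\<close>, and it divides every such \<open>n\<close> (\<open>returns_iff_period_dvd\<close>).

  In characteristic \<open>p\<close>, writing \<open>t\<^sup>n = 1 + (F\<^sub>n t + G\<^sub>n - 1)\<close> and applying Frobenius shows that
  \<open>t\<^sup>n\<^sup>p - 1\<close> is a combination of \<open>F\<^sub>n\<^sup>p\<close> and \<open>(G\<^sub>n - 1)\<^sup>p\<close>. Hence a return modulo \<open>M\<close> becomes, after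
  multiplication by \<open>p\<close>, a return modulo \<open>M\<^sup>p\<close> (\<open>returns_mult_CHAR\<close>). For \<open>M = P\<^sup>e\<close> with \<open>e \<ge> 1\<close> this
  squeezes the period of \<open>P\<^sup>e\<^sup>+\<^sup>1\<close> between the period of \<open>P\<^sup>e\<close> and \<open>p\<close> times that period in the
  divisibility order, so each jump of the period is by a factor of exactly \<open>p\<close>
  (\<open>period_power_Suc\<close>).

  The jumps never stop: otherwise some \<open>n > 0\<close> would return modulo all powers of \<open>P\<close>, that is,
  \<open>F\<^sub>n = 0\<close> and \<open>F\<^sub>n\<^sub>+\<^sub>1 = 1\<close> would hold exactly. The norm \<open>(-b)\<^sup>n\<close> of \<open>t\<^sup>n\<close> is then \<open>1\<close>, so \<open>b\<close> is
  constant; and \<open>a\<close> is constant as well, for otherwise the degrees of the \<open>F\<^sub>n\<close> grow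
  (\<open>gfib_exact_return_imp_constants\<close>). The rest is a statement about an arbitrary sequence each of
  whose steps either is constant or multiplies by \<open>p\<close>.
\<close>

section \<open>Powers of a root of the characteristic polynomial\<close>

text \<open>The constant coefficient of \<open>t\<^sup>n\<close> modulo \<open>t\<^sup>2 - a t - b\<close>, that is, \<open>b F\<^sub>n\<^sub>-\<^sub>1\<close>; this form of it
  makes sense for \<open>n = 0\<close> too.\<close>
definition gcof :: "'a::comm_ring_1 poly \<Rightarrow> 'a poly \<Rightarrow> nat \<Rightarrow> 'a poly" where
  "gcof a b n = gfib a b (Suc n) - a * gfib a b n"

lemma gcof_0: "gcof a b 0 = 1"
  by (simp add: gcof_def)

lemma gcof_Suc: "gcof a b (Suc n) = b * gfib a b n"
  by (simp add: gcof_def)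

lemma gfib_Suc: "gfib a b (Suc n) = gcof a b n + a * gfib a b n"
  by (simp add: gcof_def)

text \<open>These are the coefficients of \<open>t\<close> in \<open>t\<^sup>m t\<^sup>n = (F\<^sub>m t + G\<^sub>m) t\<^sup>n\<close>.\<close>
lemma gfib_add:
  "gfib a b (m + n) = gfib a b m * gfib a b (Suc n) + gcof a b m * gfib a b n"
proof (induction n rule: induct_nat_012)
  case (ge2 n)
  have "gfib a b (m + Suc (Suc n)) = a * gfib a b (m + Suc n) + b * gfib a b (m + n)"
    by simp
  also have "\<dots> = gfib a b m * gfib a b (Suc (Suc (Suc n))) + gcof a b m * gfib a b (Suc (Suc n))"
    unfolding ge2 by (simp add: algebra_simps)
  finally show ?case .
qed (simp_all add: gcof_def algebra_simps)

text \<open>The norm of \<open>F\<^sub>n t + G\<^sub>n\<close> is the \<open>n\<close>-th power of the norm \<open>-b\<close> of \<open>t\<close>.\<close>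
lemma gfib_norm:
  "gfib a b (Suc n) * gcof a b n - b * (gfib a b n)\<^sup>2 = (-b) ^ n"
proof (induction n)
  case 0
  then show ?case by (simp add: gcof_0)
next
  case (Suc n)
  have "gfib a b (Suc (Suc n)) * gcof a b (Suc n) - b * (gfib a b (Suc n))\<^sup>2
      = (-b) * (gfib a b (Suc n) * gcof a b n - b * (gfib a b n)\<^sup>2)"
    by (simp add: gcof_Suc power2_eq_square gcof_def algebra_simps)
  then show ?case using Suc by simp
qed

lemma char_poly_dvd_power_minus:
  "[:- b, - a, 1:] dvd [:0, 1:] ^ n - [:gcof a b n, gfib a b n:]"
proof (induction n)
  case 0
  then show ?case by (simp add: gcof_0 one_pCons)
next
  case (Suc n)
  have "[:0, 1:] ^ Suc n - [:gcof a b (Suc n), gfib a b (Suc n):]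
      = [:0, 1:] * ([:0, 1:] ^ n - [:gcof a b n, gfib a b n:])
        + [:- b, - a, 1:] * [:gfib a b n:]"
    by (simp add: gcof_Suc gfib_Suc algebra_simps)
  then show ?case
    using Suc by (simp only: dvd_add dvd_mult dvd_triv_left)
qed

lemma char_poly_dvd_linearD:
  fixes a b u v :: "'a::idom"
  assumes "[:- b, - a, 1:] dvd [:u, v:]"
  shows "u = 0" "v = 0"
proof -
  have "[:u, v:] = 0"
  proof (rule ccontr)
    assume "[:u, v:] \<noteq> 0"
    then have "degree [:- b, - a, 1:] \<le> degree [:u, v:]"
      using assms by (rule dvd_imp_degree_le[rotated])
    then show False by (simp split: if_splits)
  qed
  then show "u = 0" "v = 0" by simp_all
qed

text \<open>Both identities come from raising \<open>t\<^sup>n - 1 = F\<^sub>n t + (G\<^sub>n - 1)\<close> to the power \<open>p\<close>, which is additive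
  in characteristic \<open>p\<close>, and expanding the resulting \<open>t\<^sup>p\<close> once more.\<close>
lemma gfib_mult_CHAR:
  fixes a b :: "'a::idom poly"
  assumes p: "prime p" and char: "CHAR('a) = p"
  shows "gfib a b (n * p) = gfib a b n ^ p * gfib a b p"
    and "gcof a b (n * p) - 1 = (gcof a b n - 1) ^ p + gfib a b n ^ p * gcof a b p"
proof -
  let ?C = "[:- b, - a, 1:]" and ?t = "[:0, 1:] :: 'a poly poly"
  let ?F = "gfib a b" and ?G = "gcof a b"
  have CHAR: "CHAR('a poly poly) = p"
    using char by simp
  have add_power: "(x + y) ^ p = x ^ p + y ^ p" for x y :: "'a poly poly"
    by (rule freshmans_dream) (simp_all only: CHAR p)
  have const_power: "[:u:] ^ p = [:u ^ p:]" for u :: "'a poly"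
    by (simp add: poly_const_pow)
  have split: "[:?G n, ?F n:] = 1 + ([:?G n - 1:] + ?t * [:?F n:])"
    by (simp add: one_pCons)
  \<comment> \<open>the Frobenius expansion of \<open>t\<^sup>n\<^sup>p\<close>\<close>
  have "[:?G n, ?F n:] ^ p = 1 + ([:(?G n - 1) ^ p:] + ?t ^ p * [:?F n ^ p:])"
    unfolding split by (simp only: add_power power_mult_distrib const_power power_one)
  moreover have "?C dvd (?t ^ n) ^ p - [:?G n, ?F n:] ^ p"
    using char_poly_dvd_power_minus[of b a n] unfolding power_diff_sumr2 by (rule dvd_mult2)
  ultimately have 1: "?C dvd ?t ^ (n * p) - (1 + ([:(?G n - 1) ^ p:] + ?t ^ p * [:?F n ^ p:]))"
    by (simp only: power_mult)
  have 2: "?C dvd (?t ^ p - [:?G p, ?F p:]) * [:?F n ^ p:]"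
    using char_poly_dvd_power_minus[of b a p] by (rule dvd_mult2)
  have 3: "?C dvd ?t ^ (n * p) - [:?G (n * p), ?F (n * p):]"
    by (rule char_poly_dvd_power_minus)
  have "?C dvd (?t ^ (n * p) - (1 + ([:(?G n - 1) ^ p:] + ?t ^ p * [:?F n ^ p:])))
      + (?t ^ p - [:?G p, ?F p:]) * [:?F n ^ p:]
      - (?t ^ (n * p) - [:?G (n * p), ?F (n * p):])"
    by (rule dvd_diff[OF dvd_add[OF 1 2] 3])
  also have "\<dots> = [:?G (n * p), ?F (n * p):] - (1 + [:(?G n - 1) ^ p:])
      - [:?G p, ?F p:] * [:?F n ^ p:]"
    by (simp only: algebra_simps)
  also have "\<dots> = [:?G (n * p) - 1 - ((?G n - 1) ^ p + ?F n ^ p * ?G p),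
      ?F (n * p) - ?F n ^ p * ?F p:]"
    by (simp add: one_pCons algebra_simps)
  finally show "?F (n * p) = ?F n ^ p * ?F p"
    and "?G (n * p) - 1 = (?G n - 1) ^ p + ?F n ^ p * ?G p"
    by (auto dest: char_poly_dvd_linearD)
qed

section \<open>Returns and the period\<close>

definition returns :: "'a::field poly \<Rightarrow> 'a poly \<Rightarrow> 'a poly \<Rightarrow> nat \<Rightarrow> bool" where
  "returns a b M n \<longleftrightarrow> [gfib a b n = 0] (mod M) \<and> [gfib a b (n + 1) = 1] (mod M)"

lemma returns_iff_dvd_gcof:
  "returns a b M n \<longleftrightarrow> M dvd gfib a b n \<and> M dvd gcof a b n - 1"
proof -
  have "gfib a b (Suc n) - 1 = (gcof a b n - 1) + a * gfib a b n"
    by (simp add: gfib_Suc)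
  then show ?thesis
    unfolding returns_def by (metis Suc_eq_plus1 cong_0_iff cong_iff_dvd_diff dvd_add_left_iff dvd_mult)
qed

lemma returns_mono_dvd: "returns a b N n \<Longrightarrow> M dvd N \<Longrightarrow> returns a b M n"
  by (auto simp: returns_iff_dvd_gcof intro: dvd_trans)

lemma returns_add_iff:
  assumes "returns a b M m"
  shows "returns a b M (m + n) \<longleftrightarrow> returns a b M n"
proof -
  have shift: "[gfib a b (m + k) = gfib a b k] (mod M)" for k
  proof -
    have "gfib a b (m + k) - gfib a b k
        = gfib a b m * gfib a b (Suc k) + (gcof a b m - 1) * gfib a b k"
      by (simp only: gfib_add) (simp add: algebra_simps)
    then show ?thesis
      using assms by (simp add: returns_iff_dvd_gcof cong_iff_dvd_diff)
  qed
  show ?thesis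
    unfolding returns_def using shift[of n] shift[of "Suc n"]
    by (simp add: cong_def)
qed

lemma returns_mult: "returns a b M m \<Longrightarrow> returns a b M (k * m)"
proof (induction k)
  case 0
  then show ?case by (simp add: returns_def)
qed (simp add: returns_add_iff)

lemma finite_poly_degree_le: "finite {f :: 'a::{zero,finite} poly. degree f \<le> d}"
proof (rule finite_subset)
  show "{f :: 'a poly. degree f \<le> d} \<subseteq> Poly ` {cs. set cs \<subseteq> UNIV \<and> length cs \<le> Suc d}"
  proof
    fix f :: "'a poly" assume "f \<in> {f. degree f \<le> d}"
    then have "length (coeffs f) \<le> Suc d"
      by (cases "f = 0") (simp_all add: length_coeffs_degree)
    then show "f \<in> Poly ` {cs. set cs \<subseteq> UNIV \<and> length cs \<le> Suc d}"
      by (intro image_eqI[of _ _ "coeffs f"]) simp_all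
  qed
qed (intro finite_imageI finite_lists_length_le finite)

text \<open>Regularity (\<open>b\<close> is no zero divisor modulo \<open>M\<close>) is the form in which the coprimality of \<open>b\<close> and
  \<open>M\<close> enters below: it allows the recurrence to run backwards.\<close>
definition regular_mod :: "'a::comm_ring_1 poly \<Rightarrow> 'a poly \<Rightarrow> bool" where
  "regular_mod b M \<longleftrightarrow> (\<forall>z. M dvd b * z \<longrightarrow> M dvd z)"

lemma regular_mod_irreducible_power:
  fixes b P :: "'a::field poly"
  assumes "irreducible P" "coprime b P"
  shows "regular_mod b (P ^ k)"
proof -
  have P: "prime_elem P"
    using assms(1) by (rule field_poly_irreducible_imp_prime)
  then have b: "\<not> P dvd b"
    using assms(2) coprime_common_divisor[of b P P] by (auto simp: prime_elem_def)
  show ?thesis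
  proof (cases "k = 0")
    case True
    then show ?thesis by (simp add: regular_mod_def)
  next
    case False
    then show ?thesis
      unfolding regular_mod_def using prime_power_dvd_multD[OF P _ _ b] by blast
  qed
qed

text \<open>Two equal states, that is, pairs of consecutive residues, may be shifted back until the first of them is the initial one.\<close>
lemma returns_diff_of_equal_states:
  assumes "regular_mod b M"
    and "[gfib a b (i + d) = gfib a b i] (mod M)"
    and "[gfib a b (Suc (i + d)) = gfib a b (Suc i)] (mod M)"
  shows "returns a b M d"
  using assms(2,3)
proof (induction i)
  case 0
  then show ?case by (simp add: returns_def)
next
  case (Suc i)
  have "M dvd (gfib a b (Suc (Suc (i + d))) - gfib a b (Suc (Suc i)))
      - a * (gfib a b (Suc (i + d)) - gfib a b (Suc i))"
    using Suc.prems by (simp only: cong_iff_dvd_diff add_Suc dvd_diff dvd_mult)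
  also have "\<dots> = b * (gfib a b (i + d) - gfib a b i)"
    by (simp add: algebra_simps)
  finally have "M dvd gfib a b (i + d) - gfib a b i"
    using assms(1) by (simp only: regular_mod_def)
  then show ?case
    using Suc by (simp add: cong_iff_dvd_diff)
qed

text \<open>Pigeonhole on the pairs of consecutive residues.\<close>
lemma ex_returns:
  fixes a b M :: "'a::{field,finite} poly"
  assumes "M \<noteq> 0" "regular_mod b M"
  shows "\<exists>n>0. returns a b M n"
proof -
  define state where "state n = (gfib a b n mod M, gfib a b (Suc n) mod M)" for n
  have "degree (f mod M) \<le> degree M" for f
    using degree_mod_less[OF assms(1), of f] by auto
  then have "range state \<subseteq> {f. degree f \<le> degree M} \<times> {f. degree f \<le> degree M}"
    unfolding state_def by blast
  then have "finite (range state)"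
    by (rule finite_subset) (intro finite_cartesian_product finite_poly_degree_le)
  then have "\<not> inj state"
    using finite_imageD infinite_UNIV_nat by blast
  then obtain i j where "i < j" "state j = state i"
    unfolding inj_def by (metis linorder_neqE_nat)
  then have "returns a b M (j - i)"
    using assms(2) by (intro returns_diff_of_equal_states[where i = i]) (simp_all add: state_def cong_def)
  then show ?thesis
    using \<open>i < j\<close> by (intro exI[of _ "j - i"]) simp
qed

lemma
  fixes a b M :: "'a::{field,finite} poly"
  assumes "M \<noteq> 0" "regular_mod b M"
  shows period_pos: "period a b M > 0"
    and returns_period: "returns a b M (period a b M)"
proof -
  have "period a b M > 0 \<and> returns a b M (period a b M)"
    unfolding period_def returns_def[symmetric]
    using ex_returns[OF assms] by (rule LeastI_ex)
  then show "period a b M > 0" "returns a b M (period a b M)" by simp_all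
qed

lemma returns_iff_period_dvd:
  fixes a b M :: "'a::{field,finite} poly"
  assumes "M \<noteq> 0" "regular_mod b M"
  shows "returns a b M n \<longleftrightarrow> period a b M dvd n"
proof
  let ?k = "period a b M"
  assume "returns a b M n"
  then have "returns a b M (n div ?k * ?k + n mod ?k)" by simp
  then have r: "returns a b M (n mod ?k)"
    using returns_add_iff[OF returns_mult[OF returns_period[OF assms]]] by blast
  have "n mod ?k < ?k"
    using period_pos[OF assms] by simp
  then have "\<not> (n mod ?k > 0 \<and> returns a b M (n mod ?k))"
    unfolding period_def returns_def by (rule not_less_Least)
  then have "n mod ?k = 0"
    using r by simp
  then show "?k dvd n" by (simp add: mod_eq_0_iff_dvd)
next
  assume "period a b M dvd n"
  then show "returns a b M n"
    using returns_mult[OF returns_period[OF assms], where a = a and k = "n div period a b M"] by simp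
qed

section \<open>Passing from one power to the next\<close>

lemma returns_mult_CHAR:
  fixes a b M :: "'a::field poly"
  assumes "prime p" "CHAR('a) = p" "returns a b M n"
  shows "returns a b (M ^ p) (n * p)"
  using assms(3) unfolding returns_iff_dvd_gcof gfib_mult_CHAR[OF assms(1,2)]
  by (auto intro!: dvd_add dvd_mult2 dvd_power_same)

text \<open>The two divisibilities leave a quotient of periods that divides the prime \<open>p\<close>. The exponent
  has to be positive: then \<open>e + 1 \<le> e p\<close>.\<close>
lemma period_power_Suc:
  fixes a b P :: "'a::{field,finite} poly"
  assumes p: "prime p" "CHAR('a) = p" and P: "irreducible P" "coprime b P" and "e > 0"
  shows "period a b (P ^ Suc e) \<in> {period a b (P ^ e), p * period a b (P ^ e)}"
proof -
  let ?\<pi> = "\<lambda>e. period a b (P ^ e)"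
  have P': "P ^ k \<noteq> 0" "regular_mod b (P ^ k)" for k
    using P regular_mod_irreducible_power[OF P] by auto
  have "returns a b (P ^ e) (?\<pi> (Suc e))"
    using returns_period[OF P'] by (rule returns_mono_dvd) (simp add: le_imp_power_dvd)
  then have "?\<pi> e dvd ?\<pi> (Suc e)"
    by (simp only: returns_iff_period_dvd[OF P'])
  then obtain k where k: "?\<pi> (Suc e) = ?\<pi> e * k" ..
  have "2 * e \<le> e * p"
    using prime_ge_2_nat[OF p(1)] by simp
  then have "Suc e \<le> e * p"
    using \<open>e > 0\<close> by linarith
  moreover have "returns a b (P ^ (e * p)) (?\<pi> e * p)"
    using returns_mult_CHAR[OF p returns_period[OF P']] by (simp only: power_mult)
  ultimately have "returns a b (P ^ Suc e) (?\<pi> e * p)"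
    using returns_mono_dvd[OF _ le_imp_power_dvd] by blast
  then have "?\<pi> e * k dvd ?\<pi> e * p"
    by (simp only: returns_iff_period_dvd[OF P'] k)
  then have "k dvd p"
    using period_pos[OF P', of a e] by simp
  then have "k = 1 \<or> k = p"
    using p(1) prime_nat_iff by blast
  then show ?thesis
    using k by auto
qed

section \<open>Unboundedness of the periods\<close>

text \<open>For constant \<open>b\<close> the summand \<open>a F\<^sub>n\<^sub>-\<^sub>1\<close> of the recurrence dominates.\<close>
lemma gfib_degree:
  fixes a b :: "'a::idom poly"
  assumes "degree a > 0" "degree b = 0"
  shows "gfib a b (Suc n) \<noteq> 0 \<and> degree (gfib a b (Suc n)) = n * degree a"
proof (induction n rule: induct_nat_012)
  case (ge2 n)
  let ?f = "a * gfib a b (Suc (Suc n))" and ?g = "b * gfib a b (Suc n)"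
  have "a \<noteq> 0" using assms(1) by auto
  then have deg: "degree ?f = Suc (Suc n) * degree a"
    using ge2 by (simp add: degree_mult_eq)
  have "degree ?g \<le> n * degree a"
    using degree_mult_le[of b "gfib a b (Suc n)"] ge2 assms(2) by simp
  also have "\<dots> < degree ?f"
    unfolding deg using assms(1) by simp
  finally have "degree (?f + ?g) = degree ?f"
    by (rule degree_add_eq_left)
  then show ?case
    using deg assms(1) by (auto simp del: mult_Suc)
qed (use assms in auto)

lemma gfib_exact_return_imp_constants:
  fixes a b :: "'a::field poly"
  assumes "n > 0" "gfib a b n = 0" "gfib a b (Suc n) = 1"
  shows "degree a = 0 \<and> degree b = 0"
proof -
  have "(- b) ^ n = 1"
    using gfib_norm[of a b n] assms by (simp add: gcof_def)
  then have "- b dvd 1"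
    using \<open>n > 0\<close> by (metis dvd_power)
  then have b: "degree b = 0"
    using is_unit_iff_degree[of "- b"] by (cases "b = 0") auto
  moreover have "degree a = 0"
    using gfib_degree[of a b "n - 1"] assms b by (cases n) auto
  ultimately show ?thesis by simp
qed

lemma eq_0_if_all_powers_dvd:
  fixes f P :: "'a::field poly"
  assumes "degree P > 0" "\<And>e. e \<ge> N \<Longrightarrow> P ^ e dvd f"
  shows "f = 0"
proof (rule ccontr)
  assume "f \<noteq> 0"
  let ?e = "max N (Suc (degree f))"
  have "degree (P ^ ?e) \<le> degree f"
    using dvd_imp_degree_le[OF assms(2)[of ?e] \<open>f \<noteq> 0\<close>] by simp
  then have "?e * degree P \<le> degree f"
    by (subst (asm) degree_power_eq) (use assms(1) in auto)
  moreover have "?e * 1 \<le> ?e * degree P"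
    using assms(1) by (intro mult_le_mono2) simp
  ultimately show False by simp
qed

section \<open>Sequences that jump by a constant factor\<close>

lemma eq_if_no_jump_between:
  fixes f :: "nat \<Rightarrow> 'b"
  assumes "m \<le> n" "\<And>k. m \<le> k \<Longrightarrow> k < n \<Longrightarrow> f k = f (Suc k)"
  shows "f n = f m"
  using assms
proof (induction n rule: dec_induct)
  case (step n)
  then show ?case
    by (metis less_SucI lessI)
qed simp

lemma at_enumerated_jump:
  fixes f :: "nat \<Rightarrow> nat" and p :: nat
  defines "J \<equiv> {e. e > 0 \<and> f e \<noteq> f (Suc e)}"
  assumes inf: "infinite J" and step: "\<And>e. e > 0 \<Longrightarrow> f (Suc e) \<in> {f e, p * f e}"
  shows "f (enumerate J k) = p ^ k * f 1"
proof (induction k)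
  case 0
  have "enumerate J 0 > 0"
    using enumerate_in_set[OF inf, of 0] by (simp add: J_def)
  moreover have "f e = f (Suc e)" if "1 \<le> e" "e < enumerate J 0" for e
  proof -
    have "e \<notin> J"
      using that(2) unfolding enumerate_0 by (rule not_less_Least)
    then show ?thesis
      using that(1) by (simp add: J_def)
  qed
  ultimately have "f (enumerate J 0) = f 1"
    using eq_if_no_jump_between[of 1 "enumerate J 0" f] by simp
  then show ?case by simp
next
  case (Suc k)
  let ?u = "enumerate J k" and ?v = "enumerate J (Suc k)"
  have u: "?u > 0" "f ?u \<noteq> f (Suc ?u)"
    using enumerate_in_set[OF inf, of k] by (simp_all add: J_def)
  have "f e = f (Suc e)" if "Suc ?u \<le> e" "e < ?v" for e
  proof -
    have "\<not> (e \<in> J \<and> ?u < e)"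
      using that(2) unfolding enumerate_Suc''[OF inf] by (rule not_less_Least)
    then show ?thesis
      using that(1) by (simp add: J_def)
  qed
  then have "f ?v = f (Suc ?u)"
    using enumerate_step[OF inf, of k] eq_if_no_jump_between[of "Suc ?u" ?v f] by (simp only: Suc_leI)
  also have "\<dots> = p * f ?u"
    using u step[of ?u] by auto
  finally show ?case
    using Suc by simp
qed

text \<open>The index is that of the first jump at or after \<open>e\<close>.\<close>
lemma between_enumerated_jumps:
  fixes f :: "nat \<Rightarrow> 'b"
  defines "J \<equiv> {e. e > 0 \<and> f e \<noteq> f (Suc e)}"
  assumes inf: "infinite J" and "e > 0"
  obtains k where "k = 0 \<or> enumerate J (k - 1) < e" "e \<le> enumerate J k" "f e = f (enumerate J k)"
proof -
  define m where "m = (LEAST m. m \<in> J \<and> e \<le> m)"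
  have "\<exists>m. m \<in> J \<and> e \<le> m"
    using inf by (meson infinite_nat_iff_unbounded_le)
  then have m: "m \<in> J" "e \<le> m"
    unfolding m_def by (metis (mono_tags, lifting) LeastI_ex)+
  have below: "j < e" if "j \<in> J" "j < m" for j
    using not_less_Least[of j "\<lambda>m. m \<in> J \<and> e \<le> m"] that unfolding m_def by auto
  obtain k where k: "enumerate J k = m"
    using enumerate_Ex[OF inf m(1)] by blast
  have "enumerate J (k - 1) < e" if "k \<noteq> 0"
    using that enumerate_mono[OF _ inf, of "k - 1" k] k
    by (intro below enumerate_in_set inf) simp
  moreover have "f j = f (Suc j)" if "e \<le> j" "j < m" for j
    using below[of j] that \<open>e > 0\<close> by (auto simp: J_def)
  then have "f m = f e"
    using eq_if_no_jump_between[of e m f] m(2) by blast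
  ultimately show thesis
    using that[of k] k m(2) by auto
qed

section \<open>The periods modulo the powers of \<open>P\<close>\<close>

lemma infinite_jumps:
  fixes a b P :: "'a::{field,finite} poly"
  assumes "irreducible P" "coprime b P" and nonconst: "\<not> (degree a = 0 \<and> degree b = 0)"
  shows "infinite (jumps a b P)"
proof
  let ?\<pi> = "\<lambda>e. period a b (P ^ e)"
  assume "finite (jumps a b P)"
  then obtain N where N: "\<And>e. e \<in> jumps a b P \<Longrightarrow> e < N"
    by (metis finite_nat_set_iff_bounded)
  have P: "P ^ k \<noteq> 0" "regular_mod b (P ^ k)" for k
    using assms(1) regular_mod_irreducible_power[OF assms(1,2)] by auto
  have "P \<noteq> 0" "\<not> P dvd 1"
    using assms(1) by (auto simp: irreducible_def)
  then have "degree P > 0"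
    using is_unit_iff_degree by blast
  let ?n = "?\<pi> (Suc N)"
  have "?\<pi> k = ?\<pi> (Suc k)" if "Suc N \<le> k" for k
    using N[of k] that by (force simp: jumps_def)
  then have "?\<pi> e = ?n" if "e \<ge> Suc N" for e
    using eq_if_no_jump_between[OF that, of ?\<pi>] by blast
  then have "returns a b (P ^ e) ?n" if "e \<ge> Suc N" for e
    using returns_period[OF P, of a e] that by simp
  then have "P ^ e dvd gfib a b ?n" "P ^ e dvd gfib a b (Suc ?n) - 1" if "e \<ge> Suc N" for e
    using that by (auto simp: returns_def cong_0_iff cong_iff_dvd_diff)
  then have "gfib a b ?n = 0" "gfib a b (Suc ?n) - 1 = 0"
    using eq_0_if_all_powers_dvd[OF \<open>degree P > 0\<close>, of "Suc N"] by blast+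
  then show False
    using gfib_exact_return_imp_constants[of ?n a b] period_pos[OF P, of a "Suc N"] nonconst by simp
qed

lemma CHAR_eq_if_CARD_prime_power:
  assumes "prime p" "CARD('a::{field,finite}) = p ^ l"
  shows "CHAR('a) = p"
proof -
  have "prime CHAR('a)"
    by (intro prime_CHAR_semidom finite_imp_CHAR_pos) simp
  moreover have "CHAR('a) dvd p ^ l"
    using CHAR_dvd_CARD[where 'a = 'a] assms(2) by simp
  ultimately show ?thesis
    using assms(1) by (metis prime_dvd_power primes_dvd_imp_eq)
qed

theorem theorem4p16:
  fixes a b P :: "'a::{field,finite} poly" and p l :: nat
  assumes "prime p" and "l \<ge> 1" and "CARD('a) = p ^ l"
    and "b \<noteq> 0"
    and "irreducible P" and "coprime b P"
    and "\<not> (a \<in> range (\<lambda>c. [:c:]) \<and> b \<in> range (\<lambda>c. [:c:]))"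
  shows "infinite (jumps a b P) \<and>
    (\<forall>e\<ge>1. \<exists>i\<ge>1. nth_jump a b P (i - 1) < e \<and> e \<le> nth_jump a b P i \<and>
       period a b (P ^ e) = period a b (P ^ nth_jump a b P i) \<and>
       period a b (P ^ nth_jump a b P i) = p ^ (i - 1) * period a b P)"
proof -
  let ?\<pi> = "\<lambda>e. period a b (P ^ e)"
  have "\<not> (degree a = 0 \<and> degree b = 0)"
    using assms(7) by (metis degree_eq_zeroE rangeI)
  then have inf: "infinite (jumps a b P)"
    using assms(5,6) by (intro infinite_jumps)
  have J: "jumps a b P = {e. e > 0 \<and> ?\<pi> e \<noteq> ?\<pi> (Suc e)}"
    by (simp add: jumps_def)
  have step: "?\<pi> (Suc e) \<in> {?\<pi> e, p * ?\<pi> e}" if "e > 0" for e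
    using that assms CHAR_eq_if_CARD_prime_power[OF assms(1,3)] by (intro period_power_Suc)
  have jump: "?\<pi> (enumerate (jumps a b P) k) = p ^ k * period a b P" for k
    using at_enumerated_jump[of ?\<pi> p k] inf step unfolding J by simp
  have "\<exists>i\<ge>1. nth_jump a b P (i - 1) < e \<and> e \<le> nth_jump a b P i \<and>
      ?\<pi> e = ?\<pi> (nth_jump a b P i) \<and>
      ?\<pi> (nth_jump a b P i) = p ^ (i - 1) * period a b P" if "e \<ge> 1" for e
  proof -
    have "e > 0" using that by simp
    then obtain k where "k = 0 \<or> enumerate (jumps a b P) (k - 1) < e"
      "e \<le> enumerate (jumps a b P) k" "?\<pi> e = ?\<pi> (enumerate (jumps a b P) k)"
      by (rule between_enumerated_jumps[where f = ?\<pi> and e = e, folded J, OF inf])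
    then show ?thesis
      using jump[of k] \<open>e > 0\<close> by (intro exI[of _ "Suc k"]) (auto simp: nth_jump_def)
  qed
  then show ?thesis
    using inf by blast
qed

end
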